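(* Let $N=2$. The functions $\tilde f_{i,1}$, $i=0,1,2,3$, are (pairwise) orthogonal CHFIFs in $\mathcal{S}_0^1$ if and only if the following conditions are satisfied: (a) $|\alpha_1|<1$, $|\alpha_2|<1$, $|\gamma_1|<1$, $|\gamma_2|<1$, $|\beta_1|+|\gamma_1|<1$ and $|\beta_2|+|\gamma_2|<1$. (b) The values of $r_1$ and $s_1$ are $$r_1=\frac{4-4\alpha_1^2-6\alpha_2-2\alpha_1\alpha_2+3\alpha_1^2\alpha_2-4\alpha_2^2+3\alpha_2^3}{4(-4+\alpha_1^2-\alpha_1\alpha_2+\alpha_2^2)},\qquad s_1=\frac{4-6\alpha_1-4\alpha_1^2+3\alpha_1^3-2\alpha_1\alpha_2-4\alpha_2^2+3\alpha_1\alpha_2^2}{4(-4+\alpha_1^2-\alpha_1\alpha_2+\alpha_2^2)},$$ and $u_{1,1}$ is the value for which $\langle\tilde f_{3,1},\tilde f_{1,1}\rangle=0$. (c) $\rho(\alpha_1,\alpha_2)=0$, where $$\begin{aligned}\rho(\alpha_1,\alpha_2)={}&8+12\alpha_1-28\alpha_1^2+6\alpha_1^3+2\alpha_1^4+12\alpha_2-14\alpha_1\alpha_2+18\alpha_1^2\alpha_2-7\alpha_1^3\alpha_2\\&-28\alpha_2^2+18\alpha_1\alpha_2^2+6\alpha_2^3-7\alpha_1\alpha_2^3+2\alpha_2^4.\end{aligned}$$ (d) $\zeta=0$ and $\eta=0$, where $\zeta=\langle\tilde f_{0,1},\tilde f_{3,1}\rangle$ and $\eta=\langle\tilde f_{2,1},\tilde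 f_{3,1}\rangle$ (computed with the values of $r_1,s_1,u_{1,1}$ in (b)).
   Context: Let $N=2$, $x_0=0$, $x_1=\frac12$, $x_2=1$, $I=[0,1]$, $L_1(x)=\frac x2$, $L_2(x)=\frac{x+1}{2}$, and let $\alpha_1,\alpha_2,\gamma_1,\gamma_2,\beta_1,\beta_2$ be real parameters. The CHFIF (Coalescence Hidden-variable Fractal Interpolation Function) construction requires $|\alpha_n|<1$, $|\gamma_n|<1$, $|\beta_n|+|\gamma_n|<1$, $n=1,2$. For data $\{(x_i,y_i,z_i): i=0,1,2\}$, $f=(f_1,f_2):I\to\mathbb{R}^2$ is the unique continuous function satisfying, for all $x\in I$ and $n=1,2$, $$f_1(L_n(x))=\alpha_nf_1(x)+\beta_nf_2(x)+p_n(x),\qquad f_2(L_n(x))=\gamma_nf_2(x)+q_n(x),$$ where $p_n,q_n$ are the polynomials of degree at most one determined by $\alpha_ny_0+\beta_nz_0+p_n(0)=y_{n-1}$, $\gamma_nz_0+q_n(0)=z_{n-1}$, $\alpha_ny_2+\beta_nz_2+p_n(1)=y_n$, $\gamma_nz_2+q_n(1)=z_n$; then $f(x_i)=(y_i,z_i)$. The function $f_1$ is the CHFIF and $f_2$ the AFIF (Affine Fractal Interpolation Function) of the data. $\mathcal{S}_0$ is the vector space of all such $f=(f_1,f_2)$ (data varying, parameters fixed) and $\mathcal{S}_0^1$ is the space of their first components. With real parameters $r_1,s_1,u_{1,1}$, the functions $\tilde f_i=(\tilde f_{i,1},\tilde f_{i,2})$, $i=0,1,2,3$, are the functions so constructed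 from the following data: - $\tilde f_{0,1}$: $\big((0,1),(\tfrac12,r_1),(1,0)\big)$; - $\tilde f_{1,1}$: $\big((0,0),(\tfrac12,1),(1,0)\big)$; - $\tilde f_{2,1}$: $\big((0,0),(\tfrac12,s_1),(1,1)\big)$; - $\tilde f_{3,1}$: $\big((0,0),(\tfrac12,u_{1,1}),(1,0)\big)$; - $\tilde f_{i,2}$, $i=0,1,2$: $\big((0,0),(\tfrac12,0),(1,0)\big)$; - $\tilde f_{3,2}$: $\big((0,0),(\tfrac12,1),(1,0)\big)$. The inner product is $\langle g,h\rangle=\int_0^1g(x)h(x)\,dx$. *)

theory Defs
  imports "HOL-Analysis.Analysis" "HOL-Computational_Algebra.Polynomial"
begin

text \<open>
  Throughout, the maps and parameters are indexed by \<open>n \<in> {1, 2}\<close> and the interpolation data by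
  \<open>i \<in> {0, 1, 2}\<close>; values of the indexing functions elsewhere are never used. The knots
  are \<open>0\<close>, \<open>1/2\<close>, \<open>1\<close>.
\<close>

definition L :: "nat \<Rightarrow> real \<Rightarrow> real" where
  "L n x = (x + (real n - 1)) / 2"

definition admissible :: "(nat \<Rightarrow> real) \<Rightarrow> (nat \<Rightarrow> real) \<Rightarrow> (nat \<Rightarrow> real) \<Rightarrow> bool" where
  "admissible \<alpha> \<gamma> \<beta> \<longleftrightarrow>
     (\<forall>n\<in>{1, 2}. \<bar>\<alpha> n\<bar> < 1 \<and> \<bar>\<gamma> n\<bar> < 1 \<and> \<bar>\<beta> n\<bar> + \<bar>\<gamma> n\<bar> < 1)"

text \<open>
  \<open>is_hidden_FIF \<alpha> \<gamma> \<beta> y z f\<close>: the function \<open>f = (f\<^sub>1, f\<^sub>2)\<close> is produced by the CHFIF construction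
  from the data \<open>(y i, z i)\<close>. The parameter restrictions are part of the construction, so for
  parameters violating them nothing is a CHFIF. A function on the unit interval is represented
  by its extensional representative, which makes it literally unique.
\<close>

definition is_hidden_FIF ::
  "(nat \<Rightarrow> real) \<Rightarrow> (nat \<Rightarrow> real) \<Rightarrow> (nat \<Rightarrow> real) \<Rightarrow> (nat \<Rightarrow> real) \<Rightarrow> (nat \<Rightarrow> real) \<Rightarrow>
   (real \<Rightarrow> real \<times> real) \<Rightarrow> bool" where
  "is_hidden_FIF \<alpha> \<gamma> \<beta> y z f \<longleftrightarrow>
     admissible \<alpha> \<gamma> \<beta> \<and> f \<in> extensional {0..1} \<and> continuous_on {0..1} f \<and>
     (\<exists>p q :: nat \<Rightarrow> real poly. \<forall>n\<in>{1, 2}.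
        degree (p n) \<le> 1 \<and> degree (q n) \<le> 1 \<and>
        \<alpha> n * y 0 + \<beta> n * z 0 + poly (p n) 0 = y (n - 1) \<and>
        \<gamma> n * z 0 + poly (q n) 0 = z (n - 1) \<and>
        \<alpha> n * y 2 + \<beta> n * z 2 + poly (p n) 1 = y n \<and>
        \<gamma> n * z 2 + poly (q n) 1 = z n \<and>
        (\<forall>x\<in>{0..1}.
           fst (f (L n x)) = \<alpha> n * fst (f x) + \<beta> n * snd (f x) + poly (p n) x \<and>
           snd (f (L n x)) = \<gamma> n * snd (f x) + poly (q n) x))"

definition hidden_FIF ::
  "(nat \<Rightarrow> real) \<Rightarrow> (nat \<Rightarrow> real) \<Rightarrow> (nat \<Rightarrow> real) \<Rightarrow> (nat \<Rightarrow> real) \<Rightarrow> (nat \<Rightarrow> real) \<Rightarrow>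
   real \<Rightarrow> real \<times> real" where
  "hidden_FIF \<alpha> \<gamma> \<beta> y z = (THE f. is_hidden_FIF \<alpha> \<gamma> \<beta> y z f)"

definition first_comp :: "(real \<Rightarrow> real \<times> real) \<Rightarrow> real \<Rightarrow> real" where
  "first_comp f = (\<lambda>x\<in>{0..1}. fst (f x))"

definition S0 ::
  "(nat \<Rightarrow> real) \<Rightarrow> (nat \<Rightarrow> real) \<Rightarrow> (nat \<Rightarrow> real) \<Rightarrow> (real \<Rightarrow> real \<times> real) set" where
  "S0 \<alpha> \<gamma> \<beta> = {f. \<exists>y z. is_hidden_FIF \<alpha> \<gamma> \<beta> y z f}"

definition S01 ::
  "(nat \<Rightarrow> real) \<Rightarrow> (nat \<Rightarrow> real) \<Rightarrow> (nat \<Rightarrow> real) \<Rightarrow> (real \<Rightarrow> real) set" where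
  "S01 \<alpha> \<gamma> \<beta> = first_comp ` S0 \<alpha> \<gamma> \<beta>"

definition ip :: "(real \<Rightarrow> real) \<Rightarrow> (real \<Rightarrow> real) \<Rightarrow> real" where
  "ip g h = integral {0..1} (\<lambda>x. g x * h x)"

definition tilde_y :: "real \<Rightarrow> real \<Rightarrow> real \<Rightarrow> nat \<Rightarrow> nat \<Rightarrow> real" where
  "tilde_y r s u i = (\<lambda>j. [[1, r, 0], [0, 1, 0], [0, s, 1], [0, u, 0]] ! i ! j)"

definition tilde_z :: "nat \<Rightarrow> nat \<Rightarrow> real" where
  "tilde_z i = (\<lambda>j. [[0, 0, 0], [0, 0, 0], [0, 0, 0], [0, 1, 0]] ! i ! j)"

definition tilde_f ::
  "(nat \<Rightarrow> real) \<Rightarrow> (nat \<Rightarrow> real) \<Rightarrow> (nat \<Rightarrow> real) \<Rightarrow> real \<Rightarrow> real \<Rightarrow> real \<Rightarrow> nat \<Rightarrow>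
   real \<Rightarrow> real \<times> real" where
  "tilde_f \<alpha> \<gamma> \<beta> r s u i = hidden_FIF \<alpha> \<gamma> \<beta> (tilde_y r s u i) (tilde_z i)"

definition tilde_f1 ::
  "(nat \<Rightarrow> real) \<Rightarrow> (nat \<Rightarrow> real) \<Rightarrow> (nat \<Rightarrow> real) \<Rightarrow> real \<Rightarrow> real \<Rightarrow> real \<Rightarrow> nat \<Rightarrow>
   real \<Rightarrow> real" where
  "tilde_f1 \<alpha> \<gamma> \<beta> r s u i = first_comp (tilde_f \<alpha> \<gamma> \<beta> r s u i)"

definition rho :: "real \<Rightarrow> real \<Rightarrow> real" where
  "rho a b =
     8 + 12 * a - 28 * a^2 + 6 * a^3 + 2 * a^4 + 12 * b - 14 * a * b + 18 * a^2 * b - 7 * a^3 * b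
     - 28 * b^2 + 18 * a * b^2 + 6 * b^3 - 7 * a * b^3 + 2 * b^4"

definition zeta ::
  "(nat \<Rightarrow> real) \<Rightarrow> (nat \<Rightarrow> real) \<Rightarrow> (nat \<Rightarrow> real) \<Rightarrow> real \<Rightarrow> real \<Rightarrow> real \<Rightarrow> real" where
  "zeta \<alpha> \<gamma> \<beta> r s u = ip (tilde_f1 \<alpha> \<gamma> \<beta> r s u 0) (tilde_f1 \<alpha> \<gamma> \<beta> r s u 3)"

definition eta ::
  "(nat \<Rightarrow> real) \<Rightarrow> (nat \<Rightarrow> real) \<Rightarrow> (nat \<Rightarrow> real) \<Rightarrow> real \<Rightarrow> real \<Rightarrow> real \<Rightarrow> real" where
  "eta \<alpha> \<gamma> \<beta> r s u = ip (tilde_f1 \<alpha> \<gamma> \<beta> r s u 2) (tilde_f1 \<alpha> \<gamma> \<beta> r s u 3)"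

end

theory Submission
  imports Defs
begin

text \<open>
  Once the parameters are admissible, the construction is a fixed point problem with exactly one
  solution, so \<open>f\<close> depends linearly on the data. This reduces everything to one function
  \<open>\<phi> = f\<^sub>1\<^sub>1\<close>, the interpolant of \<open>(0, 1, 0)\<close> with vanishing hidden variable. Affine functions
  interpolate their own values, and hence the other three
  functions are (lemma \<open>tilde_f1_decomp\<close>) \<open>1 - x + (r - 1/2) \<phi>\<close>, \<open>x + (s - 1/2) \<phi>\<close>, and a function that moves along the line of
  direction \<open>\<phi>\<close> when \<open>u\<close> varies.

  Write \<open>a = \<alpha> 1\<close>, \<open>b = \<alpha> 2\<close>, \<open>A = \<integral>\<phi>\<close>, \<open>B = \<integral>x\<phi>\<close>, \<open>C = \<integral>\<phi>\<^sup>2\<close>. The equations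
  \<open>\<phi>(x/2) = a \<phi>(x) + x\<close> and \<open>\<phi>((x+1)/2) = b \<phi>(x) + 1 - x\<close>, integrated over the two halves of
  the interval, give linear equations for these moments; with
  \<open>D = (2 - a - b)(4 - a - b)\<close> their solution is (lemma \<open>bump_moments\<close>)
  \<open>A - B = (2 - b)/D\<close>, \<open>B = (2 - a)/D\<close>,
  \<open>C = 4(4 - a\<^sup>2 + ab - b\<^sup>2) / (3(2 - a\<^sup>2 - b\<^sup>2)D)\<close>.

  The inner products of \<open>\<phi>\<close> with functions 0 and 2 are \<open>(r - 1/2) C + (A - B)\<close> and
  \<open>(s - 1/2) C + B\<close>. Since \<open>C > 0\<close>, each vanishes for exactly one value of the parameter, and this
  is the stated one. For these values the inner product of functions 0 and 2 is
  \<open>1/6 - B (A - B) / C\<close>, which is a nonzero multiple of \<open>\<rho>(a, b)\<close>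
  (lemma \<open>orthogonality_algebra\<close>). The inner product of function 3 with \<open>\<phi>\<close> is affine in \<open>u\<close> with
  slope \<open>C > 0\<close>, so it vanishes for exactly one \<open>u\<close>
  (lemma \<open>ip_tilde_f1_3_1_unique_zero\<close>). The two remaining pairs are \<open>\<zeta>\<close> and \<open>\<eta>\<close>
  by definition. If the parameters are not admissible, there are no CHFIFs and both sides fail.
\<close>

section \<open>Self-affine functional equations on the unit interval\<close>

(* The index 1 of a map must keep its numeral form: simplification of 2 - 1 produces Suc 0. *)
declare One_nat_def [simp del] One_nat_def [symmetric, simp]

definition clip :: "real \<Rightarrow> real" where
  "clip t = max 0 (min 1 t)"

lemma clip_in [simp]: "clip t \<in> {0..1}" "0 \<le> clip t" "clip t \<le> 1"
  by (auto simp: clip_def)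

lemma clip_id: "t \<in> {0..1} \<Longrightarrow> clip t = t"
  by (auto simp: clip_def)

lemma L_simps [simp]: "L 1 x = x / 2" "L 2 x = (x + 1) / 2"
  by (auto simp: L_def)

lemma L_in: "n \<in> {1, 2} \<Longrightarrow> x \<in> {0..1} \<Longrightarrow> L n x \<in> {0..1}"
  by auto

lemma ex_L_preimage:
  assumes "x \<in> {0..1}"
  obtains n t where "n \<in> {1, 2}" "t \<in> {0..1}" "x = L n t"
proof (cases "x \<le> 1/2")
  case True
  then show ?thesis using assms that[of 1 "2 * x"] by auto
next
  case False
  then show ?thesis using assms that[of 2 "2 * x - 1"] by auto
qed

text \<open>
  At a point \<open>L n t\<close> where \<open>\<bar>f - g\<bar>\<close> is maximal, the maximum is \<open>\<bar>a n\<bar>\<close> times the value at \<open>t\<close>,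
  hence at most \<open>\<bar>a n\<bar> < 1\<close> times itself.
\<close>
lemma self_affine_unique:
  fixes f g :: "real \<Rightarrow> real" and a :: "nat \<Rightarrow> real"
  assumes cf: "continuous_on {0..1} f" and cg: "continuous_on {0..1} g"
    and a: "\<And>n. n \<in> {1, 2} \<Longrightarrow> \<bar>a n\<bar> < 1"
    and f: "\<And>n x. n \<in> {1, 2} \<Longrightarrow> x \<in> {0..1} \<Longrightarrow> f (L n x) = a n * f x + h n x"
    and g: "\<And>n x. n \<in> {1, 2} \<Longrightarrow> x \<in> {0..1} \<Longrightarrow> g (L n x) = a n * g x + h n x"
    and x: "x \<in> {0..1}"
  shows "f x = g x"
proof -
  define d where "d x = \<bar>f x - g x\<bar>" for x
  have "continuous_on {0..1} d"
    unfolding d_def by (intro continuous_intros cf cg)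
  then obtain m where m: "m \<in> {0..1}" "\<And>t. t \<in> {0..1} \<Longrightarrow> d t \<le> d m"
    using continuous_attains_sup[of "{0..1::real}" d] by auto
  obtain n t where nt: "n \<in> {1, 2}" "t \<in> {0..1}" "m = L n t"
    using ex_L_preimage[OF m(1)] .
  have "d m = \<bar>a n\<bar> * d t"
    using f[OF nt(1,2)] g[OF nt(1,2)]
    by (simp add: nt(3) d_def abs_mult[symmetric] right_diff_distrib)
  also have "\<dots> \<le> \<bar>a n\<bar> * d m"
    using m(2)[OF nt(2)] by (simp add: mult_left_mono)
  finally have "(1 - \<bar>a n\<bar>) * d m \<le> 0"
    by (simp add: algebra_simps)
  then have "d m \<le> 0"
    using a[OF nt(1)] by (simp add: mult_le_0_iff)
  then show ?thesis
    using m(2)[OF x] by (simp add: d_def)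
qed

text \<open>
  The solution is the fixed point of a contraction. Its two branches need not be glued: with
  clamped arguments, the operator \<open>T\<close> below adds to the first branch the increment of the second
  branch from its left end. The first branch stays at its right end value for \<open>x \<ge> 1/2\<close>, the
  increment vanishes for \<open>x \<le> 1/2\<close>, and the hypothesis \<open>join\<close> makes the sum equal to the second
  branch on the right half. The operator is considered on the functions with end values \<open>u\<close> and
  \<open>v\<close>; \<open>left\<close> and \<open>right\<close> say that it preserves this set.
\<close>
lemma self_affine_exists:
  fixes a :: "nat \<Rightarrow> real" and h :: "nat \<Rightarrow> real \<Rightarrow> real"
  assumes a: "\<And>n. n \<in> {1, 2} \<Longrightarrow> \<bar>a n\<bar> < 1"
    and ch: "\<And>n. n \<in> {1, 2} \<Longrightarrow> continuous_on {0..1} (h n)"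
    and left: "a 1 * u + h 1 0 = u"
    and right: "a 2 * v + h 2 1 = v"
    and join: "a 1 * v + h 1 1 = a 2 * u + h 2 0"
  obtains f where "continuous_on {0..1} f" "f 0 = u" "f 1 = v"
    "\<And>n x. n \<in> {1, 2} \<Longrightarrow> x \<in> {0..1} \<Longrightarrow> f (L n x) = a n * f x + h n x"
proof -
  define T where "T g x = a 1 * g (clip (2 * x)) + h 1 (clip (2 * x))
      + (a 2 * (g (clip (2 * x - 1)) - u) + (h 2 (clip (2 * x - 1)) - h 2 0))"
    for g :: "real \<Rightarrow> real" and x
  define c where "c = max \<bar>a 1\<bar> \<bar>a 2\<bar>"
  define S where "S = {F :: real \<Rightarrow>\<^sub>C real. F 0 = u \<and> F 1 = v}"
  have c: "0 \<le> c" "c < 1" and ac: "\<bar>a 1\<bar> \<le> c" "\<bar>a 2\<bar> \<le> c"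
    using a[of 1] a[of 2] by (auto simp: c_def)
  have cclip: "continuous_on UNIV (\<lambda>x. k (clip (m * x + b)))"
    if "continuous_on {0..1} k" for k :: "real \<Rightarrow> real" and m b
  proof (rule continuous_on_compose2[OF that])
    show "continuous_on UNIV (\<lambda>x. clip (m * x + b))"
      unfolding clip_def by (intro continuous_intros)
  qed auto
  have clip_cont: "(\<lambda>x. k (clip x)) \<in> bcontfun" if "continuous_on {0..1} k" for k :: "real \<Rightarrow> real"
  proof -
    have "continuous_on UNIV (\<lambda>x. k (clip x))"
      using cclip[OF that, of 1 0] by simp
    moreover have "bounded (k ` {0..1})"
      using that by (intro compact_imp_bounded compact_continuous_image) auto
    then have "bounded (range (\<lambda>x. k (clip x)))"
      by (rule bounded_subset) auto
    ultimately show ?thesis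
      by (simp add: bcontfun_def)
  qed
  have cT: "continuous_on {0..1} (T g)" if "continuous_on {0..1} g" for g
    unfolding T_def
    using cclip[OF that, of 2 0] cclip[OF that, of 2 "-1"]
      cclip[OF ch, of 1 2 0] cclip[OF ch, of 2 2 "-1"]
    by (intro continuous_intros) (auto intro: continuous_on_subset)
  \<comment> \<open>Clamping the variable extends functions on the unit interval to bounded continuous functions
    on the line, which form a complete metric space.\<close>
  define TT where "TT F = Bcontfun (\<lambda>x. T (apply_bcontfun F) (clip x))" for F
  have TT: "apply_bcontfun (TT F) x = T (apply_bcontfun F) (clip x)" for F x
    unfolding TT_def by (subst Bcontfun_inverse) (auto intro!: clip_cont cT)
  have T1: "T g (L 1 x) = a 1 * g x + h 1 x" if "x \<in> {0..1}" "g 0 = u" for g x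
  proof -
    have "clip (2 * L 1 x - 1) = 0" "clip (2 * L 1 x) = x"
      using that by (auto simp: clip_def)
    then show ?thesis using that by (simp add: T_def)
  qed
  have T2: "T g (L 2 x) = a 2 * g x + h 2 x" if "x \<in> {0..1}" "g 1 = v" for g x
  proof -
    have "clip (2 * L 2 x - 1) = x" "clip (2 * L 2 x) = 1"
      using that by (auto simp: clip_def field_simps)
    then show ?thesis using that join by (simp add: T_def algebra_simps)
  qed
  have "\<exists>!F\<in>S. TT F = F"
  proof (rule Banach_fix)
    have S_eq: "S = PiC {0, 1} (\<lambda>x. if x = 0 then {u} else {v})"
      by (auto simp: S_def mem_PiC_iff)
    have "closed S"
      unfolding S_eq by (rule closed_PiC) auto
    then show "complete S"
      by (simp add: complete_eq_closed)
    have "Bcontfun (\<lambda>x. u + (v - u) * clip x) \<in> S"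
      using clip_cont[of "\<lambda>x. u + (v - u) * x"]
      by (auto simp: S_def Bcontfun_inverse clip_def continuous_intros)
    then show "S \<noteq> {}" by auto
    show "0 \<le> c" "c < 1" by fact+
    show "TT ` S \<subseteq> S"
    proof safe
      fix F assume "F \<in> S"
      then have F: "F 0 = u" "F 1 = v" by (auto simp: S_def)
      have "T F 0 = u" "T F 1 = v"
        using T1[of 0 F] T2[of 1 F] F left right by auto
      then show "TT F \<in> S"
        by (auto simp: S_def TT clip_id)
    qed
    fix F G assume FG: "F \<in> S" "G \<in> S"
    then have e: "F 0 = u" "F 1 = v" "G 0 = u" "G 1 = v"
      by (auto simp: S_def)
    show "dist (TT F) (TT G) \<le> c * dist F G"
    proof (rule dist_bound)
      fix x :: real
      obtain n t where nt: "n \<in> {1, 2}" "t \<in> {0..1}" "clip x = L n t"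
        using ex_L_preimage[OF clip_in(1)] .
      have "T F (clip x) - T G (clip x) = a n * (F t - G t)"
        using nt T1[of t F] T1[of t G] T2[of t F] T2[of t G] e
        by (auto simp: algebra_simps)
      then have "dist (TT F x) (TT G x) = \<bar>a n\<bar> * dist (F t) (G t)"
        by (simp add: TT dist_real_def abs_mult)
      also have "\<dots> \<le> c * dist F G"
        using ac nt(1) c by (intro mult_mono dist_bounded) auto
      finally show "dist (TT F x) (TT G x) \<le> c * dist F G" .
    qed
  qed
  then obtain F where F: "F \<in> S" "TT F = F" by auto
  then have e: "F 0 = u" "F 1 = v" by (auto simp: S_def)
  have fixed: "F x = T F x" if "x \<in> {0..1}" for x
    using TT[of F x] F(2) that by (simp add: clip_id)
  have "F (L n x) = a n * F x + h n x" if "n \<in> {1, 2}" "x \<in> {0..1}" for n x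
    using fixed[OF L_in[OF that]] that T1[of x F] T2[of x F] e by auto
  then show ?thesis
    using that[of F] e by auto
qed

section \<open>The interpolation functions: existence, uniqueness and superposition\<close>

definition chord :: "real \<Rightarrow> real \<Rightarrow> real \<Rightarrow> real" where
  "chord s t x = s + (t - s) * x"

lemma poly_degree_le_1:
  fixes p :: "real poly"
  assumes "degree p \<le> 1"
  shows "poly p x = chord (poly p 0) (poly p 1) x"
proof -
  have "p = [:coeff p 0, coeff p 1:]"
    using degree1_coeffs[of p] assms by (metis coeff_pCons_0 coeff_pCons_Suc One_nat_def pCons_0_0 degree_0_id le_SucE le_zero_eq)
  then obtain s t where "p = [:s, t:]" by metis
  then show ?thesis by (simp add: chord_def)
qed

text \<open>
  The end conditions determine the affine polynomials \<open>p n\<close> and \<open>q n\<close>, so the existential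
  quantifier over them can be eliminated.
\<close>
lemma is_hidden_FIF_iff:
  "is_hidden_FIF \<alpha> \<gamma> \<beta> y z f \<longleftrightarrow>
     admissible \<alpha> \<gamma> \<beta> \<and> f \<in> extensional {0..1} \<and> continuous_on {0..1} f \<and>
     (\<forall>n\<in>{1, 2}. \<forall>x\<in>{0..1}.
        fst (f (L n x)) = \<alpha> n * fst (f x) + \<beta> n * snd (f x)
          + chord (y (n - 1) - \<alpha> n * y 0 - \<beta> n * z 0) (y n - \<alpha> n * y 2 - \<beta> n * z 2) x \<and>
        snd (f (L n x)) = \<gamma> n * snd (f x)
          + chord (z (n - 1) - \<gamma> n * z 0) (z n - \<gamma> n * z 2) x)"
    (is "?l \<longleftrightarrow> ?A \<and> ?E \<and> ?C \<and> ?R")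
proof
  assume l: ?l
  then have A: ?A ?E ?C
    by (simp_all only: is_hidden_FIF_def)
  obtain p q :: "nat \<Rightarrow> real poly" where
    pq: "\<forall>n\<in>{1, 2}. degree (p n) \<le> 1 \<and> degree (q n) \<le> 1 \<and>
        \<alpha> n * y 0 + \<beta> n * z 0 + poly (p n) 0 = y (n - 1) \<and>
        \<gamma> n * z 0 + poly (q n) 0 = z (n - 1) \<and>
        \<alpha> n * y 2 + \<beta> n * z 2 + poly (p n) 1 = y n \<and>
        \<gamma> n * z 2 + poly (q n) 1 = z n \<and>
        (\<forall>x\<in>{0..1}.
           fst (f (L n x)) = \<alpha> n * fst (f x) + \<beta> n * snd (f x) + poly (p n) x \<and>
           snd (f (L n x)) = \<gamma> n * snd (f x) + poly (q n) x)"
    using l unfolding is_hidden_FIF_def by (elim conjE exE) (rule that)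
  have ?R
  proof (intro ballI)
    fix n :: nat and x :: real assume n: "n \<in> {1, 2}" and x: "x \<in> {0..1}"
    note pqn = bspec[OF pq n]
    have "poly (p n) x = chord (y (n - 1) - \<alpha> n * y 0 - \<beta> n * z 0) (y n - \<alpha> n * y 2 - \<beta> n * z 2) x"
      using pqn poly_degree_le_1[of "p n" x] by (metis add_diff_cancel_left' diff_diff_add)
    moreover have "poly (q n) x = chord (z (n - 1) - \<gamma> n * z 0) (z n - \<gamma> n * z 2) x"
      using pqn poly_degree_le_1[of "q n" x] by (metis add_diff_cancel_left')
    ultimately show "fst (f (L n x)) = \<alpha> n * fst (f x) + \<beta> n * snd (f x)
          + chord (y (n - 1) - \<alpha> n * y 0 - \<beta> n * z 0) (y n - \<alpha> n * y 2 - \<beta> n * z 2) x \<and>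
        snd (f (L n x)) = \<gamma> n * snd (f x)
          + chord (z (n - 1) - \<gamma> n * z 0) (z n - \<gamma> n * z 2) x"
      using pqn x by metis
  qed
  with A show "?A \<and> ?E \<and> ?C \<and> ?R" by blast
next
  assume r: "?A \<and> ?E \<and> ?C \<and> ?R"
  define P where "P s t = [:s, t - s:]" for s t :: real
  have P: "degree (P s t) \<le> 1" "poly (P s t) x = chord s t x" for s t x
    by (auto simp: P_def chord_def)
  have c: "chord s t 0 = s" "chord s t 1 = t" for s t
    by (auto simp: chord_def)
  show ?l
    unfolding is_hidden_FIF_def
    using r
    by (intro conjI
          exI[of _ "\<lambda>n. P (y (n - 1) - \<alpha> n * y 0 - \<beta> n * z 0) (y n - \<alpha> n * y 2 - \<beta> n * z 2)"]
          exI[of _ "\<lambda>n. P (z (n - 1) - \<gamma> n * z 0) (z n - \<gamma> n * z 2)"])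
      (simp_all only: P c, simp_all)
qed

text \<open>
  The system is triangular: the second component satisfies an equation of its own, and then enters
  the equation of the first component as a known inhomogeneity. This holds for uniqueness and for
  existence alike.
\<close>
lemma hidden_FIF_unique:
  assumes f: "is_hidden_FIF \<alpha> \<gamma> \<beta> y z f" and g: "is_hidden_FIF \<alpha> \<gamma> \<beta> y z g"
  shows "f = g"
proof -
  have adm: "\<And>n. n \<in> {1, 2} \<Longrightarrow> \<bar>\<alpha> n\<bar> < 1" "\<And>n. n \<in> {1, 2} \<Longrightarrow> \<bar>\<gamma> n\<bar> < 1"
    using f unfolding is_hidden_FIF_def admissible_def by blast+
  note F = f[unfolded is_hidden_FIF_iff] and G = g[unfolded is_hidden_FIF_iff]
  have snd: "snd (f x) = snd (g x)" if "x \<in> {0..1}" for x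
    by (rule self_affine_unique[where f = "\<lambda>x. snd (f x)" and g = "\<lambda>x. snd (g x)" and a = \<gamma>
          and h = "\<lambda>n. chord (z (n - 1) - \<gamma> n * z 0) (z n - \<gamma> n * z 2)"])
      (use F G adm that in \<open>auto intro!: continuous_intros\<close>)
  have fst: "fst (f x) = fst (g x)" if "x \<in> {0..1}" for x
    by (rule self_affine_unique[where f = "\<lambda>x. fst (f x)" and g = "\<lambda>x. fst (g x)" and a = \<alpha>
          and h = "\<lambda>n x. \<beta> n * snd (f x) + chord (y (n - 1) - \<alpha> n * y 0 - \<beta> n * z 0)
                (y n - \<alpha> n * y 2 - \<beta> n * z 2) x"])
      (use F G adm that snd in \<open>auto intro!: continuous_intros\<close>)
  show ?thesis
    using F G fst snd by (intro extensionalityI[of f "{0..1}" g]) (auto intro: prod_eqI)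
qed

lemma hidden_FIF_exists:
  assumes "admissible \<alpha> \<gamma> \<beta>"
  obtains f where "is_hidden_FIF \<alpha> \<gamma> \<beta> y z f"
proof -
  have adm: "\<And>n. n \<in> {1, 2} \<Longrightarrow> \<bar>\<alpha> n\<bar> < 1" "\<And>n. n \<in> {1, 2} \<Longrightarrow> \<bar>\<gamma> n\<bar> < 1"
    using assms unfolding admissible_def by blast+
  have cc: "continuous_on S (chord s t)" for S s t
    unfolding chord_def by (intro continuous_intros)
  obtain f2 where f2: "continuous_on {0..1} f2" "f2 0 = z 0" "f2 1 = z 2"
    "\<And>n x. n \<in> {1, 2} \<Longrightarrow> x \<in> {0..1} \<Longrightarrow> f2 (L n x) = \<gamma> n * f2 x
        + chord (z (n - 1) - \<gamma> n * z 0) (z n - \<gamma> n * z 2) x"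
    by (rule self_affine_exists[of \<gamma> "\<lambda>n. chord (z (n - 1) - \<gamma> n * z 0) (z n - \<gamma> n * z 2)" "z 0" "z 2"])
      (use adm cc in \<open>auto simp: chord_def[of _ _ 0] chord_def[of _ _ 1]\<close>)
  obtain f1 where f1: "continuous_on {0..1} f1"
    "\<And>n x. n \<in> {1, 2} \<Longrightarrow> x \<in> {0..1} \<Longrightarrow> f1 (L n x) = \<alpha> n * f1 x + (\<beta> n * f2 x
        + chord (y (n - 1) - \<alpha> n * y 0 - \<beta> n * z 0) (y n - \<alpha> n * y 2 - \<beta> n * z 2) x)"
    by (rule self_affine_exists[of \<alpha> "\<lambda>n x. \<beta> n * f2 x
        + chord (y (n - 1) - \<alpha> n * y 0 - \<beta> n * z 0) (y n - \<alpha> n * y 2 - \<beta> n * z 2) x" "y 0" "y 2"])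
      (use adm cc f2 in \<open>auto simp: chord_def[of _ _ 0] chord_def[of _ _ 1] intro!: continuous_intros\<close>)
  have "is_hidden_FIF \<alpha> \<gamma> \<beta> y z (\<lambda>x\<in>{0..1}. (f1 x, f2 x))"
    unfolding is_hidden_FIF_iff
  proof (intro conjI ballI)
    show "continuous_on {0..1} (\<lambda>x\<in>{0..1}. (f1 x, f2 x))"
      by (rule continuous_on_eq[of _ "\<lambda>x. (f1 x, f2 x)"]) (auto intro!: continuous_intros f1 f2)
  qed (use assms f1(2) f2(4) L_in in \<open>simp_all del: atLeastAtMost_iff insert_iff L_simps\<close>)
  then show ?thesis using that by blast
qed

lemma is_hidden_FIF_hidden_FIF:
  assumes "admissible \<alpha> \<gamma> \<beta>"
  shows "is_hidden_FIF \<alpha> \<gamma> \<beta> y z (hidden_FIF \<alpha> \<gamma> \<beta> y z)"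
proof -
  obtain f where f: "is_hidden_FIF \<alpha> \<gamma> \<beta> y z f"
    using hidden_FIF_exists[OF assms] .
  show ?thesis
    unfolding hidden_FIF_def by (rule theI[where P = "is_hidden_FIF \<alpha> \<gamma> \<beta> y z", OF f]) (rule hidden_FIF_unique[OF _ f])
qed

lemma hidden_FIF_eqI:
  "is_hidden_FIF \<alpha> \<gamma> \<beta> y z f \<Longrightarrow> hidden_FIF \<alpha> \<gamma> \<beta> y z = f"
  by (rule hidden_FIF_unique[OF is_hidden_FIF_hidden_FIF]) (simp_all add: is_hidden_FIF_def)

text \<open>
  The functional equations are linear in the function and the data together, so uniqueness turns
  linear relations between data into relations between interpolants.
\<close>
lemma hidden_FIF_superpose:
  assumes adm: "admissible \<alpha> \<gamma> \<beta>"
    and y: "\<And>i. i \<in> {0, 1, 2} \<Longrightarrow> y i = y1 i + c * y2 i"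
    and z: "\<And>i. i \<in> {0, 1, 2} \<Longrightarrow> z i = z1 i + c * z2 i"
    and x: "x \<in> {0..1}"
  shows "hidden_FIF \<alpha> \<gamma> \<beta> y z x = hidden_FIF \<alpha> \<gamma> \<beta> y1 z1 x + c *\<^sub>R hidden_FIF \<alpha> \<gamma> \<beta> y2 z2 x"
proof -
  let ?f = "hidden_FIF \<alpha> \<gamma> \<beta> y1 z1" and ?g = "hidden_FIF \<alpha> \<gamma> \<beta> y2 z2"
  note F = is_hidden_FIF_hidden_FIF[OF adm, of y1 z1, unfolded is_hidden_FIF_iff]
  note G = is_hidden_FIF_hidden_FIF[OF adm, of y2 z2, unfolded is_hidden_FIF_iff]
  have "is_hidden_FIF \<alpha> \<gamma> \<beta> y z (\<lambda>x\<in>{0..1}. ?f x + c *\<^sub>R ?g x)"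
    unfolding is_hidden_FIF_iff
  proof (intro conjI)
    show "continuous_on {0..1} (\<lambda>x\<in>{0..1}. ?f x + c *\<^sub>R ?g x)"
      by (rule continuous_on_eq[of _ "\<lambda>x. ?f x + c *\<^sub>R ?g x"])
        (use F G in \<open>auto intro!: continuous_intros\<close>)
    show "\<forall>n\<in>{1, 2}. \<forall>x\<in>{0..1}.
        fst ((\<lambda>x\<in>{0..1}. ?f x + c *\<^sub>R ?g x) (L n x)) =
          \<alpha> n * fst ((\<lambda>x\<in>{0..1}. ?f x + c *\<^sub>R ?g x) x) + \<beta> n * snd ((\<lambda>x\<in>{0..1}. ?f x + c *\<^sub>R ?g x) x)
          + chord (y (n - 1) - \<alpha> n * y 0 - \<beta> n * z 0) (y n - \<alpha> n * y 2 - \<beta> n * z 2) x \<and>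
        snd ((\<lambda>x\<in>{0..1}. ?f x + c *\<^sub>R ?g x) (L n x)) =
          \<gamma> n * snd ((\<lambda>x\<in>{0..1}. ?f x + c *\<^sub>R ?g x) x)
          + chord (z (n - 1) - \<gamma> n * z 0) (z n - \<gamma> n * z 2) x"
    proof (intro ballI)
      fix n :: nat and t :: real assume n: "n \<in> {1, 2}" and t: "t \<in> {0..1}"
      have i: "n \<in> {0, 1, 2}" "n - 1 \<in> {0, 1, 2}" "0 \<in> {0, 1, 2 :: nat}" "2 \<in> {0, 1, 2 :: nat}"
        using n by auto
      note Fn = F[THEN conjunct2, THEN conjunct2, THEN conjunct2, rule_format, OF n t]
        and Gn = G[THEN conjunct2, THEN conjunct2, THEN conjunct2, rule_format, OF n t]
      show "fst ((\<lambda>x\<in>{0..1}. ?f x + c *\<^sub>R ?g x) (L n t)) =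
          \<alpha> n * fst ((\<lambda>x\<in>{0..1}. ?f x + c *\<^sub>R ?g x) t) + \<beta> n * snd ((\<lambda>x\<in>{0..1}. ?f x + c *\<^sub>R ?g x) t)
          + chord (y (n - 1) - \<alpha> n * y 0 - \<beta> n * z 0) (y n - \<alpha> n * y 2 - \<beta> n * z 2) t \<and>
        snd ((\<lambda>x\<in>{0..1}. ?f x + c *\<^sub>R ?g x) (L n t)) =
          \<gamma> n * snd ((\<lambda>x\<in>{0..1}. ?f x + c *\<^sub>R ?g x) t)
          + chord (z (n - 1) - \<gamma> n * z 0) (z n - \<gamma> n * z 2) t"
        unfolding y[OF i(1)] y[OF i(2)] y[OF i(3)] y[OF i(4)]
          z[OF i(1)] z[OF i(2)] z[OF i(3)] z[OF i(4)]
        by (simp only: restrict_apply t L_in[OF n t] if_True fst_add snd_add fst_scaleR snd_scaleR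
              Fn Gn real_scaleR_def)
          (simp add: chord_def algebra_simps)
    qed
  qed (use adm in auto)
  from hidden_FIF_eqI[OF this] show ?thesis using x by simp
qed

lemma hidden_FIF_affine_data:
  assumes adm: "admissible \<alpha> \<gamma> \<beta>"
    and y: "\<And>i. i \<in> {0, 1, 2} \<Longrightarrow> y i = m + k * (real i / 2)"
    and z: "\<And>i. i \<in> {0, 1, 2} \<Longrightarrow> z i = 0"
    and x: "x \<in> {0..1}"
  shows "hidden_FIF \<alpha> \<gamma> \<beta> y z x = (m + k * x, 0)"
proof -
  have "is_hidden_FIF \<alpha> \<gamma> \<beta> y z (\<lambda>x\<in>{0..1}. (m + k * x, 0))"
    unfolding is_hidden_FIF_iff
  proof (intro conjI)
    show "continuous_on {0..1} (\<lambda>x\<in>{0..1}. (m + k * x, 0::real))"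
      by (rule continuous_on_eq[of _ "\<lambda>x. (m + k * x, 0)"]) (auto intro!: continuous_intros)
  qed (use adm in \<open>auto simp: y z chord_def field_simps\<close>)
  from hidden_FIF_eqI[OF this] show ?thesis using x by simp
qed

section \<open>Moments of a self-affine function\<close>

lemma integral_halves:
  fixes F :: "real \<Rightarrow> real"
  assumes "continuous_on {0..1} F"
  shows "2 * integral {0..1} F = integral {0..1} (\<lambda>x. F (L 1 x)) + integral {0..1} (\<lambda>x. F (L 2 x))"
proof -
  have *: "integral {0..1} (\<lambda>x. F ((x + d) / 2)) = 2 * integral {d/2..(d+1)/2} F"
    if "d = 0 \<or> d = 1" for d
  proof -
    have "F integrable_on {d/2..(d+1)/2}"
      using that by (intro integrable_continuous_real continuous_on_subset[OF assms]) auto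
    then have "(F has_integral integral {d/2..(d+1)/2} F) (cbox (d/2) ((d+1)/2))"
      by (simp add: integrable_integral)
    from has_integral_affinity[OF this, of "1/2" "d/2"]
    have "((\<lambda>x. F (x / 2 + d / 2)) has_integral 2 * integral {d/2..(d+1)/2} F)
        ((\<lambda>x. 2 * x - d) ` {d/2..(d+1)/2})"
      by simp
    also have "(\<lambda>x. 2 * x - d) ` {d/2..(d+1)/2} = {0..1}"
      using image_affinity_atLeastAtMost_diff[of 2 d "d/2" "(d+1)/2"] that by auto
    finally show ?thesis
      by (simp add: add_divide_distrib integral_unique)
  qed
  have "integral {0..1} F = integral {0..1/2} F + integral {1/2..1} F"
    using assms by (intro Henstock_Kurzweil_Integration.integral_combine[symmetric] integrable_continuous_real) auto
  then show ?thesis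
    using *[of 0] *[of 1] by simp
qed

text \<open>
  Every integrand below is a quadratic expression of this shape in \<open>x\<close> and \<open>\<phi>\<close>, so all inner products
  reduce to the three moments of \<open>\<phi>\<close>.
\<close>
lemma integral_quadratic_form:
  fixes \<phi> :: "real \<Rightarrow> real"
  assumes \<phi>: "continuous_on {0..1} \<phi>"
    and F: "\<And>x. x \<in> {0..1} \<Longrightarrow>
      F x = c * (\<phi> x * \<phi> x) + d * (x * \<phi> x) + e * \<phi> x + (k0 + k1 * x + k2 * x^2)"
  shows "integral {0..1} F = c * ip \<phi> \<phi> + d * ip (\<lambda>x. x) \<phi> + e * integral {0..1} \<phi>
           + (k0 + k1 / 2 + k2 / 3)"
proof -
  have "((\<lambda>x. k0 + k1 * x + k2 * x^2) has_integral
      (k0 * 1 + k1 * 1^2 / 2 + k2 * 1^3 / 3) - (k0 * 0 + k1 * 0^2 / 2 + k2 * 0^3 / 3)) {0..1::real}"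
    by (rule fundamental_theorem_of_calculus)
      (auto intro!: derivative_eq_intros simp: has_real_derivative_iff_has_vector_derivative[symmetric] power2_eq_square)
  then have k: "((\<lambda>x. k0 + k1 * x + k2 * x^2) has_integral (k0 + k1 / 2 + k2 / 3)) {0..1::real}"
    by simp
  have int: "(g has_integral integral {0..1} g) {0..1}" if "continuous_on {0..1} g" for g :: "real \<Rightarrow> real"
    using that by (simp add: integrable_continuous_real integrable_integral)
  have "((\<lambda>x. c * (\<phi> x * \<phi> x) + d * (x * \<phi> x) + e * \<phi> x + (k0 + k1 * x + k2 * x^2)) has_integral
      (c * ip \<phi> \<phi> + d * ip (\<lambda>x. x) \<phi> + e * integral {0..1} \<phi> + (k0 + k1 / 2 + k2 / 3))) {0..1}"
    unfolding ip_def
    by (intro has_integral_add has_integral_mult_right int k continuous_intros \<phi>)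
  then have "(F has_integral
      (c * ip \<phi> \<phi> + d * ip (\<lambda>x. x) \<phi> + e * integral {0..1} \<phi> + (k0 + k1 / 2 + k2 / 3))) {0..1}"
    by (rule has_integral_eq[rotated]) (simp add: F)
  then show ?thesis by (rule integral_unique)
qed

text \<open>
  Splitting each of the integrals of \<open>\<phi>\<close>, \<open>x \<phi>\<close> and \<open>\<phi>\<^sup>2\<close> into halves and inserting the functional
  equation yields a triangular linear system for the moments. Its pivots \<open>2 - a - b\<close>,
  \<open>4 - a - b\<close> and \<open>2 - a\<^sup>2 - b\<^sup>2\<close> are positive. The first conclusion is the moment against
  \<open>1 - x\<close>; it mirrors the second under \<open>x \<mapsto> 1 - x\<close>, which exchanges \<open>a\<close> and \<open>b\<close>.
\<close>
lemma bump_moments: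
  fixes \<phi> :: "real \<Rightarrow> real" and a b :: real
  assumes \<phi>: "continuous_on {0..1} \<phi>" and ab: "\<bar>a\<bar> < 1" "\<bar>b\<bar> < 1"
    and \<phi>1: "\<And>x. x \<in> {0..1} \<Longrightarrow> \<phi> (L 1 x) = a * \<phi> x + x"
    and \<phi>2: "\<And>x. x \<in> {0..1} \<Longrightarrow> \<phi> (L 2 x) = b * \<phi> x + (1 - x)"
  defines "D \<equiv> (2 - a - b) * (4 - a - b)"
  shows "integral {0..1} \<phi> - ip (\<lambda>x. x) \<phi> = (2 - b) / D"
    and "ip (\<lambda>x. x) \<phi> = (2 - a) / D"
    and "ip \<phi> \<phi> = 4 * (4 - a^2 + a * b - b^2) / (3 * (2 - a^2 - b^2) * D)"
proof -
  let ?A = "integral {0..1} \<phi>" and ?B = "ip (\<lambda>x. x) \<phi>" and ?C = "ip \<phi> \<phi>"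
  have s: "2 - a - b > 0" "4 - a - b > 0" using ab by auto
  have "a^2 < 1" "b^2 < 1" using ab by (auto simp: abs_square_less_1)
  then have s2: "2 - a^2 - b^2 > 0" by auto
  have A: "2 * ?A = (a * ?A + 1/2) + (b * ?A + 1/2)"
  proof -
    have "integral {0..1} (\<lambda>x. \<phi> (L 1 x)) = 0 * ?C + 0 * ?B + a * ?A + (0 + 1 / 2 + 0 / 3)"
      by (rule integral_quadratic_form[OF \<phi>]) (simp only: \<phi>1)
    moreover have "integral {0..1} (\<lambda>x. \<phi> (L 2 x)) = 0 * ?C + 0 * ?B + b * ?A + (1 + (- 1) / 2 + 0 / 3)"
      by (rule integral_quadratic_form[OF \<phi>]) (simp only: \<phi>2)
    ultimately show ?thesis
      using integral_halves[OF \<phi>] by simp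
  qed
  have B: "2 * ?B = (a/2 * ?B + 1/6) + (b/2 * ?B + b/2 * ?A + 1/3)"
  proof -
    have "integral {0..1} (\<lambda>x. L 1 x * \<phi> (L 1 x)) = 0 * ?C + a/2 * ?B + 0 * ?A + (0 + 0 / 2 + 1/2 / 3)"
      by (rule integral_quadratic_form[OF \<phi>])
        (simp only: \<phi>1, simp add: field_simps power2_eq_square)
    moreover have "integral {0..1} (\<lambda>x. L 2 x * \<phi> (L 2 x))
        = 0 * ?C + b/2 * ?B + b/2 * ?A + (1/2 + 0 / 2 + (- 1/2) / 3)"
      by (rule integral_quadratic_form[OF \<phi>])
        (simp only: \<phi>2, simp add: field_simps power2_eq_square)
    moreover have "continuous_on {0..1} (\<lambda>x. x * \<phi> x)"
      by (intro continuous_intros \<phi>)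
    ultimately show ?thesis
      using integral_halves[of "\<lambda>x. x * \<phi> x"] by (simp add: ip_def del: L_simps)
  qed
  have C: "2 * ?C = (a^2 * ?C + 2 * a * ?B + 1/3) + (b^2 * ?C - 2 * b * ?B + 2 * b * ?A + 1/3)"
  proof -
    have "integral {0..1} (\<lambda>x. \<phi> (L 1 x) * \<phi> (L 1 x))
        = a^2 * ?C + 2 * a * ?B + 0 * ?A + (0 + 0 / 2 + 1 / 3)"
      by (rule integral_quadratic_form[OF \<phi>])
        (simp only: \<phi>1, simp add: algebra_simps power2_eq_square)
    moreover have "integral {0..1} (\<lambda>x. \<phi> (L 2 x) * \<phi> (L 2 x))
        = b^2 * ?C + (- 2 * b) * ?B + 2 * b * ?A + (1 + (- 2) / 2 + 1 / 3)"
      by (rule integral_quadratic_form[OF \<phi>])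
        (simp only: \<phi>2, simp add: algebra_simps power2_eq_square)
    moreover have "continuous_on {0..1} (\<lambda>x. \<phi> x * \<phi> x)"
      by (intro continuous_intros \<phi>)
    ultimately show ?thesis
      using integral_halves[of "\<lambda>x. \<phi> x * \<phi> x"] by (simp add: ip_def del: L_simps)
  qed
  have A': "?A = 1 / (2 - a - b)"
    using A s by (simp add: field_simps)
  have "(4 - a - b) * ?B = 1 + b * ?A"
    using B by (simp add: algebra_simps)
  also have "\<dots> = (2 - a) / (2 - a - b)"
    using s by (simp add: A' field_simps)
  finally have B4: "(4 - a - b) * ?B = (2 - a) / (2 - a - b)" .
  have "?B = ((4 - a - b) * ?B) / (4 - a - b)"
    using s by simp
  also have "\<dots> = (2 - a) / D"
    unfolding B4 by (simp add: D_def)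
  finally show B': "?B = (2 - a) / D" .
  have "?A = (4 - a - b) / D"
    using s by (simp add: A' D_def)
  then show AB: "?A - ?B = (2 - b) / D"
    by (simp add: B' diff_divide_distrib[symmetric])
  have D: "D > 0" using s by (simp add: D_def)
  have "(2 - a^2 - b^2) * ?C = 2 * a * ?B + 2 * b * (?A - ?B) + 2/3"
    using C by (simp add: algebra_simps)
  also have "\<dots> = (2 * a * (2 - a) + 2 * b * (2 - b) + 2/3 * D) / D"
    unfolding AB unfolding B' using D by (simp add: field_simps)
  also have "2 * a * (2 - a) + 2 * b * (2 - b) + 2/3 * D = 4/3 * (4 - a^2 + a * b - b^2)"
    by (simp add: D_def algebra_simps power2_eq_square)
  finally have C2: "(2 - a^2 - b^2) * ?C = 4/3 * (4 - a^2 + a * b - b^2) / D" .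
  have "?C = ((2 - a^2 - b^2) * ?C) / (2 - a^2 - b^2)"
    using s2 by simp
  also have "\<dots> = 4 * (4 - a^2 + a * b - b^2) / (3 * (2 - a^2 - b^2) * D)"
    unfolding C2 by simp
  finally show "?C = 4 * (4 - a^2 + a * b - b^2) / (3 * (2 - a^2 - b^2) * D)" .
qed

text \<open>
  With \<open>q = 4 - a\<^sup>2 + ab - b\<^sup>2\<close> and \<open>w = 2 - a\<^sup>2 - b\<^sup>2\<close>, both positive, one has
  \<open>C = 4q / (3wD)\<close>. The denominators of the stated \<open>r\<close> and \<open>s\<close> are \<open>-4q\<close>, and
  \<open>\<rho>(a, b) = 9w(2 - a)(2 - b) - 2qD\<close>; this factorised form is what appears when the third
  condition is multiplied by \<open>C\<close>.
\<close>
lemma orthogonality_algebra: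
  fixes a b r s A B C D :: real
  assumes ab: "\<bar>a\<bar> < 1" "\<bar>b\<bar> < 1"
    and D: "D = (2 - a - b) * (4 - a - b)"
    and A: "A - B = (2 - b) / D" and B: "B = (2 - a) / D"
    and C: "C = 4 * (4 - a^2 + a * b - b^2) / (3 * (2 - a^2 - b^2) * D)"
  shows "C > 0"
    and "(r - 1/2) * C + (A - B) = 0 \<longleftrightarrow>
      r = (4 - 4 * a^2 - 6 * b - 2 * a * b + 3 * a^2 * b - 4 * b^2 + 3 * b^3)
            / (4 * (- 4 + a^2 - a * b + b^2))" (is "?R \<longleftrightarrow> r = ?r")
    and "(s - 1/2) * C + B = 0 \<longleftrightarrow>
      s = (4 - 6 * a - 4 * a^2 + 3 * a^3 - 2 * a * b - 4 * b^2 + 3 * a * b^2)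
            / (4 * (- 4 + a^2 - a * b + b^2))" (is "?S \<longleftrightarrow> s = ?s")
    and "(r - 1/2) * C + (A - B) = 0 \<Longrightarrow> (s - 1/2) * C + B = 0 \<Longrightarrow>
      (r - 1/2) * (s - 1/2) * C + (r - 1/2) * B + (s - 1/2) * (A - B) + 1/6 = 0 \<longleftrightarrow> rho a b = 0"
proof -
  define q where "q = 4 - a^2 + a * b - b^2"
  define w where "w = 2 - a^2 - b^2"
  have "a^2 < 1" "b^2 < 1" using ab by (auto simp: abs_square_less_1)
  moreover have "\<bar>a * b\<bar> < 1" using ab abs_mult_less[of a 1 b 1] by (simp add: abs_mult)
  ultimately have q: "q > 0" and w: "w > 0" by (auto simp: q_def w_def)
  have Dp: "D > 0" using ab by (simp add: D)
  have C': "C = 4 * q / (3 * w * D)" by (simp add: C q_def w_def)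
  show Cp: "C > 0" using q w Dp by (simp add: C')
  have den: "4 * (- 4 + a^2 - a * b + b^2) = - (4 * q)" by (simp add: q_def)
  have "(r - 1/2) * C + (A - B) = ((r - 1/2) * (4 * q) + 3 * w * (2 - b)) / (3 * w * D)"
    unfolding A C' using w Dp by (simp add: add_divide_distrib)
  then have "?R \<longleftrightarrow> (r - 1/2) * (4 * q) + 3 * w * (2 - b) = 0"
    using w Dp by simp
  also have "\<dots> \<longleftrightarrow> r * - (4 * q) = 3 * w * (2 - b) - 2 * q"
    by (auto simp: algebra_simps)
  also have "3 * w * (2 - b) - 2 * q = 4 - 4 * a^2 - 6 * b - 2 * a * b + 3 * a^2 * b - 4 * b^2 + 3 * b^3"
    by (simp add: w_def q_def algebra_simps power2_eq_square power3_eq_cube)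
  finally show "?R \<longleftrightarrow> r = ?r"
    unfolding den using q by (subst eq_divide_eq) auto
  have "(s - 1/2) * C + B = ((s - 1/2) * (4 * q) + 3 * w * (2 - a)) / (3 * w * D)"
    unfolding B C' using w Dp by (simp add: add_divide_distrib)
  then have "?S \<longleftrightarrow> (s - 1/2) * (4 * q) + 3 * w * (2 - a) = 0"
    using w Dp by simp
  also have "\<dots> \<longleftrightarrow> s * - (4 * q) = 3 * w * (2 - a) - 2 * q"
    by (auto simp: algebra_simps)
  also have "3 * w * (2 - a) - 2 * q = 4 - 6 * a - 4 * a^2 + 3 * a^3 - 2 * a * b - 4 * b^2 + 3 * a * b^2"
    by (simp add: w_def q_def algebra_simps power2_eq_square power3_eq_cube)
  finally show "?S \<longleftrightarrow> s = ?s"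
    unfolding den using q by (subst eq_divide_eq) auto
  have rho: "rho a b = 9 * w * ((2 - a) * (2 - b)) - 2 * q * D"
    by (simp add: rho_def w_def q_def D algebra_simps power2_eq_square power3_eq_cube power4_eq_xxxx)
  assume R: ?R and S: ?S
  let ?G = "(r - 1/2) * (s - 1/2) * C + (r - 1/2) * B + (s - 1/2) * (A - B) + 1/6"
  \<comment> \<open>Completing the product exhibits the two conditions already known to hold.\<close>
  have "C * ?G = ((r - 1/2) * C + (A - B)) * ((s - 1/2) * C + B) - B * (A - B) + C / 6"
    by (simp add: field_simps)
  also have "\<dots> = C / 6 - B * (A - B)"
    by (simp only: R S)
  also have "\<dots> = 4 * q / (18 * w * D) - ((2 - a) * (2 - b)) / (D * D)"
    by (simp only: A) (simp add: B C')
  also have "\<dots> = (2 * q * D - 9 * w * ((2 - a) * (2 - b))) / (9 * w * D * D)"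
    using w Dp by (simp add: field_simps)
  finally have "C * ?G = - rho a b / (9 * w * D * D)"
    by (simp add: rho)
  then show "?G = 0 \<longleftrightarrow> rho a b = 0"
    using Cp w Dp by (metis divide_eq_0_iff mult_eq_0_iff neg_equal_0_iff_equal order_less_irrefl zero_neq_numeral)
qed

section \<open>The four basis functions\<close>

lemma tilde_values:
  "tilde_y r s u 0 0 = 1" "tilde_y r s u 0 1 = r" "tilde_y r s u 0 2 = 0"
  "tilde_y r s u 1 0 = 0" "tilde_y r s u 1 1 = 1" "tilde_y r s u 1 2 = 0"
  "tilde_y r s u 2 0 = 0" "tilde_y r s u 2 1 = s" "tilde_y r s u 2 2 = 1"
  "tilde_y r s u 3 0 = 0" "tilde_y r s u 3 1 = u" "tilde_y r s u 3 2 = 0"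
  "tilde_z 0 0 = 0" "tilde_z 0 1 = 0" "tilde_z 0 2 = 0"
  "tilde_z 1 0 = 0" "tilde_z 1 1 = 0" "tilde_z 1 2 = 0"
  "tilde_z 2 0 = 0" "tilde_z 2 1 = 0" "tilde_z 2 2 = 0"
  "tilde_z 3 0 = 0" "tilde_z 3 1 = 1" "tilde_z 3 2 = 0"
  by (simp_all add: tilde_y_def tilde_z_def nth_Cons')

lemma tilde_f1_apply:
  "x \<in> {0..1} \<Longrightarrow> tilde_f1 \<alpha> \<gamma> \<beta> r s u i x = fst (hidden_FIF \<alpha> \<gamma> \<beta> (tilde_y r s u i) (tilde_z i) x)"
  by (simp add: tilde_f1_def tilde_f_def first_comp_def)

lemma continuous_on_tilde_f1:
  assumes "admissible \<alpha> \<gamma> \<beta>"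
  shows "continuous_on {0..1} (tilde_f1 \<alpha> \<gamma> \<beta> r s u i)"
proof (rule continuous_on_eq)
  show "continuous_on {0..1} (\<lambda>x. fst (hidden_FIF \<alpha> \<gamma> \<beta> (tilde_y r s u i) (tilde_z i) x))"
    using is_hidden_FIF_hidden_FIF[OF assms]
    by (intro continuous_intros) (auto simp: is_hidden_FIF_def)
qed (simp add: tilde_f1_apply)

lemma tilde_f1_in_S01:
  "admissible \<alpha> \<gamma> \<beta> \<Longrightarrow> tilde_f1 \<alpha> \<gamma> \<beta> r s u i \<in> S01 \<alpha> \<gamma> \<beta>"
  unfolding tilde_f1_def tilde_f_def S01_def S0_def
  using is_hidden_FIF_hidden_FIF by blast

text \<open>
  The data of function 1 contain none of the free parameters.
\<close>
lemma tilde_f1_1_indep: "tilde_f1 \<alpha> \<gamma> \<beta> r s u 1 = tilde_f1 \<alpha> \<gamma> \<beta> r' s' u' 1"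
  by (simp add: tilde_f1_def tilde_f_def tilde_y_def)

text \<open>
  The data \<open>(1, r, 0)\<close> and \<open>(0, s, 1)\<close> differ from those of the affine functions \<open>1 - x\<close> and \<open>x\<close>,
  whose midpoint value is \<open>1/2\<close>, by multiples of \<open>(0, 1, 0)\<close>.
\<close>
lemma tilde_f1_decomp:
  assumes adm: "admissible \<alpha> \<gamma> \<beta>" and x: "x \<in> {0..1}"
  shows "tilde_f1 \<alpha> \<gamma> \<beta> r s u 0 x = 1 - x + (r - 1/2) * tilde_f1 \<alpha> \<gamma> \<beta> r s u 1 x"
    and "tilde_f1 \<alpha> \<gamma> \<beta> r s u 2 x = x + (s - 1/2) * tilde_f1 \<alpha> \<gamma> \<beta> r s u 1 x"
    and "tilde_f1 \<alpha> \<gamma> \<beta> r s u 3 x = tilde_f1 \<alpha> \<gamma> \<beta> r s v 3 x + (u - v) * tilde_f1 \<alpha> \<gamma> \<beta> r s u 1 x"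
proof -
  let ?H = "hidden_FIF \<alpha> \<gamma> \<beta>"
  have "?H (tilde_y r s u 0) (tilde_z 0) x = ?H (\<lambda>i. 1 + (- 1) * (real i / 2)) (\<lambda>_. 0) x
      + (r - 1/2) *\<^sub>R ?H (tilde_y r s u 1) (tilde_z 1) x"
    using adm x by (intro hidden_FIF_superpose) (auto simp: tilde_values)
  also have "?H (\<lambda>i. 1 + (- 1) * (real i / 2)) (\<lambda>_. 0) x = (1 + (- 1) * x, 0)"
    using adm x by (intro hidden_FIF_affine_data) auto
  finally show "tilde_f1 \<alpha> \<gamma> \<beta> r s u 0 x = 1 - x + (r - 1/2) * tilde_f1 \<alpha> \<gamma> \<beta> r s u 1 x"
    using x by (simp add: tilde_f1_apply)
  have "?H (tilde_y r s u 2) (tilde_z 2) x = ?H (\<lambda>i. 0 + 1 * (real i / 2)) (\<lambda>_. 0) x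
      + (s - 1/2) *\<^sub>R ?H (tilde_y r s u 1) (tilde_z 1) x"
    using adm x by (intro hidden_FIF_superpose) (auto simp: tilde_values)
  also have "?H (\<lambda>i. 0 + 1 * (real i / 2)) (\<lambda>_. 0) x = (0 + 1 * x, 0)"
    using adm x by (intro hidden_FIF_affine_data) auto
  finally show "tilde_f1 \<alpha> \<gamma> \<beta> r s u 2 x = x + (s - 1/2) * tilde_f1 \<alpha> \<gamma> \<beta> r s u 1 x"
    using x by (simp add: tilde_f1_apply)
  have "?H (tilde_y r s u 3) (tilde_z 3) x = ?H (tilde_y r s v 3) (tilde_z 3) x
      + (u - v) *\<^sub>R ?H (tilde_y r s u 1) (tilde_z 1) x"
    using adm x by (intro hidden_FIF_superpose) (auto simp: tilde_values)
  then show "tilde_f1 \<alpha> \<gamma> \<beta> r s u 3 x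
      = tilde_f1 \<alpha> \<gamma> \<beta> r s v 3 x + (u - v) * tilde_f1 \<alpha> \<gamma> \<beta> r s u 1 x"
    using x by (simp add: tilde_f1_apply)
qed

lemma tilde_f1_1_self_affine:
  assumes adm: "admissible \<alpha> \<gamma> \<beta>" and x: "x \<in> {0..1}"
  shows "tilde_f1 \<alpha> \<gamma> \<beta> r s u 1 (L 1 x) = \<alpha> 1 * tilde_f1 \<alpha> \<gamma> \<beta> r s u 1 x + x"
    and "tilde_f1 \<alpha> \<gamma> \<beta> r s u 1 (L 2 x) = \<alpha> 2 * tilde_f1 \<alpha> \<gamma> \<beta> r s u 1 x + (1 - x)"
proof -
  let ?f = "hidden_FIF \<alpha> \<gamma> \<beta> (tilde_y r s u 1) (tilde_z 1)"
  have F: "is_hidden_FIF \<alpha> \<gamma> \<beta> (tilde_y r s u 1) (tilde_z 1) ?f"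
    by (rule is_hidden_FIF_hidden_FIF[OF adm])
  \<comment> \<open>The hidden data vanish, so zero solves the equation of the second component.\<close>
  have snd: "snd (?f t) = 0" if "t \<in> {0..1}" for t
    by (rule self_affine_unique[where a = \<gamma> and h = "\<lambda>_ _. 0" and f = "\<lambda>x. snd (?f x)" and g = "\<lambda>_. 0"])
      (use F adm that in \<open>auto simp: is_hidden_FIF_iff admissible_def tilde_values
         chord_def intro!: continuous_intros\<close>)
  have e: "fst (?f (L 1 x)) = \<alpha> 1 * fst (?f x) + x" "fst (?f (L 2 x)) = \<alpha> 2 * fst (?f x) + (1 - x)"
    using F x snd[OF x] by (auto simp: is_hidden_FIF_iff tilde_values chord_def)
  show "tilde_f1 \<alpha> \<gamma> \<beta> r s u 1 (L 1 x) = \<alpha> 1 * tilde_f1 \<alpha> \<gamma> \<beta> r s u 1 x + x"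
    using e(1) x L_in[of 1 x] by (simp add: tilde_f1_apply)
  show "tilde_f1 \<alpha> \<gamma> \<beta> r s u 1 (L 2 x) = \<alpha> 2 * tilde_f1 \<alpha> \<gamma> \<beta> r s u 1 x + (1 - x)"
    using e(2) x L_in[of 2 x] by (simp add: tilde_f1_apply)
qed

lemma ip_commute: "ip g h = ip h g"
  by (simp add: ip_def mult.commute)

lemma Gram_conditions:
  fixes \<alpha> \<gamma> \<beta> :: "nat \<Rightarrow> real" and r s u :: real
  assumes adm: "admissible \<alpha> \<gamma> \<beta>"
  defines "a \<equiv> \<alpha> 1" and "b \<equiv> \<alpha> 2"
  defines "f \<equiv> tilde_f1 \<alpha> \<gamma> \<beta> r s"
  shows "ip (f u 1) (f u 1) > 0"
    and "ip (f u 0) (f u 1) = 0 \<longleftrightarrow>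
      r = (4 - 4 * a^2 - 6 * b - 2 * a * b + 3 * a^2 * b - 4 * b^2 + 3 * b^3)
            / (4 * (- 4 + a^2 - a * b + b^2))"
    and "ip (f u 2) (f u 1) = 0 \<longleftrightarrow>
      s = (4 - 6 * a - 4 * a^2 + 3 * a^3 - 2 * a * b - 4 * b^2 + 3 * a * b^2)
            / (4 * (- 4 + a^2 - a * b + b^2))"
    and "ip (f u 0) (f u 1) = 0 \<Longrightarrow> ip (f u 2) (f u 1) = 0 \<Longrightarrow>
      ip (f u 0) (f u 2) = 0 \<longleftrightarrow> rho a b = 0"
proof -
  let ?\<phi> = "f u 1"
  define A where "A = integral {0..1} ?\<phi>"
  define B where "B = ip (\<lambda>x. x) ?\<phi>"
  define C where "C = ip ?\<phi> ?\<phi>"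
  have ab: "\<bar>a\<bar> < 1" "\<bar>b\<bar> < 1"
    using adm by (auto simp: admissible_def a_def b_def)
  have \<phi>: "continuous_on {0..1} ?\<phi>"
    unfolding f_def by (rule continuous_on_tilde_f1[OF adm])
  have "?\<phi> (L 1 x) = a * ?\<phi> x + x" "?\<phi> (L 2 x) = b * ?\<phi> x + (1 - x)" if "x \<in> {0..1}" for x
    unfolding f_def a_def b_def by (rule tilde_f1_1_self_affine[OF adm that])+
  note m = bump_moments[OF \<phi> ab this, folded A_def B_def C_def]
  note alg = orthogonality_algebra[OF ab refl m]
  have f0: "f u 0 x = 1 - x + (r - 1/2) * ?\<phi> x" and f2: "f u 2 x = x + (s - 1/2) * ?\<phi> x"
    if "x \<in> {0..1}" for x
    unfolding f_def by (rule tilde_f1_decomp[OF adm that])+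
  have e01: "ip (f u 0) ?\<phi> = (r - 1/2) * C + (A - B)"
    unfolding ip_def[of "f u 0"]
    by (subst integral_quadratic_form[OF \<phi>, of _ "r - 1/2" "-1" 1 0 0 0])
      (auto simp: f0 algebra_simps A_def B_def C_def)
  have e21: "ip (f u 2) ?\<phi> = (s - 1/2) * C + B"
    unfolding ip_def[of "f u 2"]
    by (subst integral_quadratic_form[OF \<phi>, of _ "s - 1/2" 1 0 0 0 0])
      (auto simp: f2 algebra_simps B_def C_def)
  have e02: "ip (f u 0) (f u 2)
      = (r - 1/2) * (s - 1/2) * C + (r - 1/2) * B + (s - 1/2) * (A - B) + 1/6"
    unfolding ip_def[of "f u 0"]
    by (subst integral_quadratic_form[OF \<phi>, of _ "(r - 1/2) * (s - 1/2)"
          "(r - 1/2) - (s - 1/2)" "s - 1/2" 0 1 "-1"])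
      (auto simp: f0 f2 A_def B_def C_def field_simps power2_eq_square)
  show "ip ?\<phi> ?\<phi> > 0" using alg(1) by (simp add: C_def)
  show "ip (f u 0) (f u 1) = 0 \<longleftrightarrow>
      r = (4 - 4 * a^2 - 6 * b - 2 * a * b + 3 * a^2 * b - 4 * b^2 + 3 * b^3)
            / (4 * (- 4 + a^2 - a * b + b^2))"
    unfolding e01 by (rule alg(2))
  show "ip (f u 2) (f u 1) = 0 \<longleftrightarrow>
      s = (4 - 6 * a - 4 * a^2 + 3 * a^3 - 2 * a * b - 4 * b^2 + 3 * a * b^2)
            / (4 * (- 4 + a^2 - a * b + b^2))"
    unfolding e21 by (rule alg(3))
  show "ip (f u 0) (f u 1) = 0 \<Longrightarrow> ip (f u 2) (f u 1) = 0 \<Longrightarrow>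
      ip (f u 0) (f u 2) = 0 \<longleftrightarrow> rho a b = 0"
    unfolding e01 e21 e02 by (rule alg(4))
qed

text \<open>
  The inner product is affine in the parameter with positive slope \<open>ip \<phi> \<phi>\<close>. Hence a zero is
  automatically the only one, and the condition defining \<open>u\<close> is plain orthogonality.
\<close>
lemma ip_tilde_f1_3_1_unique_zero:
  fixes \<alpha> \<gamma> \<beta> :: "nat \<Rightarrow> real" and r s u :: real
  assumes adm: "admissible \<alpha> \<gamma> \<beta>"
  defines "f \<equiv> tilde_f1 \<alpha> \<gamma> \<beta> r s"
  shows "(\<forall>v. ip (f v 3) (f v 1) = 0 \<longleftrightarrow> v = u) \<longleftrightarrow> ip (f u 3) (f u 1) = 0"
proof -
  have line: "ip (f v 3) (f v 1) = ip (f u 3) (f u 1) + (v - u) * ip (f u 1) (f u 1)" for v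
  proof -
    have f1: "f v 1 = f u 1" unfolding f_def by (rule tilde_f1_1_indep)
    have c: "continuous_on {0..1} (f w i)" for w i
      unfolding f_def by (rule continuous_on_tilde_f1[OF adm])
    have int: "(g has_integral integral {0..1} g) {0..1}" if "continuous_on {0..1} g" for g :: "real \<Rightarrow> real"
      using that by (simp add: integrable_continuous_real integrable_integral)
    have "((\<lambda>x. f u 3 x * f u 1 x + (v - u) * (f u 1 x * f u 1 x)) has_integral
        ip (f u 3) (f u 1) + (v - u) * ip (f u 1) (f u 1)) {0..1}"
      unfolding ip_def
      by (intro has_integral_add has_integral_mult_right int continuous_intros c)
    then have "((\<lambda>x. f v 3 x * f v 1 x) has_integral
        ip (f u 3) (f u 1) + (v - u) * ip (f u 1) (f u 1)) {0..1}"
    proof (rule has_integral_eq[rotated])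
      fix x :: real assume "x \<in> {0..1}"
      then have "f v 3 x = f u 3 x + (v - u) * f v 1 x"
        unfolding f_def by (rule tilde_f1_decomp(3)[OF adm])
      then show "f u 3 x * f u 1 x + (v - u) * (f u 1 x * f u 1 x) = f v 3 x * f v 1 x"
        by (simp only: f1) (simp add: algebra_simps)
    qed
    then show ?thesis unfolding ip_def[of "f v 3"] by (rule integral_unique)
  qed
  have slope: "ip (f u 1) (f u 1) > 0"
    unfolding f_def by (rule Gram_conditions(1)[OF adm])
  show ?thesis
  proof
    assume zero: "ip (f u 3) (f u 1) = 0"
    show "\<forall>v. ip (f v 3) (f v 1) = 0 \<longleftrightarrow> v = u"
    proof
      fix v
      show "ip (f v 3) (f v 1) = 0 \<longleftrightarrow> v = u"
        unfolding line[of v] zero using slope by simp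
    qed
  qed blast
qed

theorem theorem4p1:
  fixes \<alpha> \<gamma> \<beta> :: "nat \<Rightarrow> real" and r\<^sub>1 s\<^sub>1 u\<^sub>1\<^sub>1 :: real
  shows
    "((\<forall>i\<in>{0..3}. tilde_f1 \<alpha> \<gamma> \<beta> r\<^sub>1 s\<^sub>1 u\<^sub>1\<^sub>1 i \<in> S01 \<alpha> \<gamma> \<beta>) \<and>
      pairwise (\<lambda>i j. ip (tilde_f1 \<alpha> \<gamma> \<beta> r\<^sub>1 s\<^sub>1 u\<^sub>1\<^sub>1 i) (tilde_f1 \<alpha> \<gamma> \<beta> r\<^sub>1 s\<^sub>1 u\<^sub>1\<^sub>1 j) = 0) {0..3})
     \<longleftrightarrow>
     (\<bar>\<alpha> 1\<bar> < 1 \<and> \<bar>\<alpha> 2\<bar> < 1 \<and> \<bar>\<gamma> 1\<bar> < 1 \<and> \<bar>\<gamma> 2\<bar> < 1 \<and>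
      \<bar>\<beta> 1\<bar> + \<bar>\<gamma> 1\<bar> < 1 \<and> \<bar>\<beta> 2\<bar> + \<bar>\<gamma> 2\<bar> < 1) \<and>
     (r\<^sub>1 = (4 - 4 * (\<alpha> 1)^2 - 6 * \<alpha> 2 - 2 * \<alpha> 1 * \<alpha> 2 + 3 * (\<alpha> 1)^2 * \<alpha> 2
             - 4 * (\<alpha> 2)^2 + 3 * (\<alpha> 2)^3)
            / (4 * (- 4 + (\<alpha> 1)^2 - \<alpha> 1 * \<alpha> 2 + (\<alpha> 2)^2)) \<and>
      s\<^sub>1 = (4 - 6 * \<alpha> 1 - 4 * (\<alpha> 1)^2 + 3 * (\<alpha> 1)^3 - 2 * \<alpha> 1 * \<alpha> 2
             - 4 * (\<alpha> 2)^2 + 3 * \<alpha> 1 * (\<alpha> 2)^2)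
            / (4 * (- 4 + (\<alpha> 1)^2 - \<alpha> 1 * \<alpha> 2 + (\<alpha> 2)^2)) \<and>
      (\<forall>u. ip (tilde_f1 \<alpha> \<gamma> \<beta> r\<^sub>1 s\<^sub>1 u 3) (tilde_f1 \<alpha> \<gamma> \<beta> r\<^sub>1 s\<^sub>1 u 1) = 0 \<longleftrightarrow> u = u\<^sub>1\<^sub>1)) \<and>
     rho (\<alpha> 1) (\<alpha> 2) = 0 \<and>
     (zeta \<alpha> \<gamma> \<beta> r\<^sub>1 s\<^sub>1 u\<^sub>1\<^sub>1 = 0 \<and> eta \<alpha> \<gamma> \<beta> r\<^sub>1 s\<^sub>1 u\<^sub>1\<^sub>1 = 0)"
    (is "?mem \<and> ?orth \<longleftrightarrow> ?a \<and> (?r \<and> ?s \<and> ?u) \<and> ?rho \<and> ?ze")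
proof -
  let ?f = "tilde_f1 \<alpha> \<gamma> \<beta> r\<^sub>1 s\<^sub>1 u\<^sub>1\<^sub>1"
  have a: "?a \<longleftrightarrow> admissible \<alpha> \<gamma> \<beta>"
    by (auto simp: admissible_def)
  have orth: "?orth \<longleftrightarrow> (ip (?f 0) (?f 1) = 0 \<and> ip (?f 2) (?f 1) = 0 \<and> ip (?f 3) (?f 1) = 0) \<and>
      ip (?f 0) (?f 2) = 0 \<and> ip (?f 0) (?f 3) = 0 \<and> ip (?f 2) (?f 3) = 0"
  proof -
    have "{0..3::nat} = {0, 1, 2, 3}" by auto
    then show ?thesis
      by (simp only: pairwise_insert) (auto simp: ip_commute)
  qed
  show ?thesis
  proof (cases "admissible \<alpha> \<gamma> \<beta>")
    case True
    note G = Gram_conditions[OF True, of r\<^sub>1 s\<^sub>1 u\<^sub>1\<^sub>1]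
    have u: "?u \<longleftrightarrow> ip (?f 3) (?f 1) = 0"
      by (rule ip_tilde_f1_3_1_unique_zero[OF True])
    show ?thesis
      unfolding orth a u zeta_def eta_def G(2)[symmetric] G(3)[symmetric]
      using True tilde_f1_in_S01[OF True] G(4) by blast
  next
    case False
    then have "S01 \<alpha> \<gamma> \<beta> = {}"
      by (simp add: S01_def S0_def is_hidden_FIF_def)
    then show ?thesis
      using False a by auto
  qed
qed

end
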